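(* Let $\triangle ABC$ be a triangle, let $A_1, A_2$ be points on the line $BC$, let $B_1, B_2$ be points on the line $CA$, and let $C_1, C_2$ be points on the line $AB$. There is a conic $\mathcal{D}$ such that the lines $AA_1$, $AA_2$, $BB_1$, $BB_2$, $CC_1$ and $CC_2$ are tangents of $\mathcal{D}$ if and only if the points $A_1$, $A_2$, $B_1$, $B_2$, $C_1$ and $C_2$ lie on the same conic $\mathcal{C}$.
   Context: This is called Bradley's theorem. For points $P$ and $Q$, $PQ$ denotes the line through them. *)

theory Defs
  imports "HOL-Analysis.Analysis"
begin

text \<open>
  Points are points of the Euclidean plane, conics are conics of its projective closure.
  The line with coordinate vector \<open>l = (a, b, c)\<close> is \<open>a x + b y + c = 0\<close>.
\<close>

definition homog :: "real^2 \<Rightarrow> real^3" where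
  "homog P = vector [P $ 1, P $ 2, 1]"

definition line_of_coords :: "real^3 \<Rightarrow> (real^2) set" where
  "line_of_coords l = {X. l \<bullet> homog X = 0}"

abbreviation line_through :: "real^2 \<Rightarrow> real^2 \<Rightarrow> (real^2) set" where
  "line_through P Q \<equiv> affine hull {P, Q}"

text \<open>
  Degenerate conics are allowed. A conic carries its point equation \<open>p\<^sup>T M p = 0\<close> and
  its line (tangential) equation \<open>l\<^sup>T N l = 0\<close>, each up to a scalar; this is the classical
  notion of a complete conic. The relation \<open>M N = k I\<close> says:

  \<^item> \<open>k \<noteq> 0\<close>: \<open>M\<close> is invertible, \<open>N\<close> is proportional to its inverse, and the lines satisfying
    the line equation are the ordinary tangents (see the lemmas below);
  \<^item> \<open>k = 0\<close>, \<open>M\<close> of rank 2: a pair of lines (possibly complex conjugate), whose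
    tangents are the lines through their common point;
  \<^item> \<open>k = 0\<close>, \<open>M\<close> of rank 1: a double line with two marked points on it (possibly equal, or
    complex conjugate), whose tangents are the lines through a marked point.

  For degenerate conics the point equation alone does not determine a useful notion of tangent:
  every line meets a double line in a double point.
\<close>

type_synonym conic = "(real^3^3) \<times> (real^3^3)"

definition is_conic :: "conic \<Rightarrow> bool" where
  "is_conic K \<longleftrightarrow> (case K of (M, N) \<Rightarrow>
     transpose M = M \<and> transpose N = N \<and> M \<noteq> 0 \<and> N \<noteq> 0 \<and> (\<exists>k. M ** N = mat k))"

definition lies_on :: "real^2 \<Rightarrow> conic \<Rightarrow> bool" where
  "lies_on P K \<longleftrightarrow> homog P \<bullet> (fst K *v homog P) = 0"

definition tangent_of :: "(real^2) set \<Rightarrow> conic \<Rightarrow> bool" where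
  "tangent_of L K \<longleftrightarrow>
     (\<exists>l. l \<noteq> 0 \<and> L = line_of_coords l \<and> l \<bullet> (snd K *v l) = 0)"

lemma mat_vec: "mat k *v (x::real^'n) = k *\<^sub>R x"
  by (simp add: vec_eq_iff matrix_vector_mult_def mat_def if_distrib if_distribR cong: if_cong)

lemma symmetric_inner:
  fixes M :: "real^'n^'n"
  assumes "transpose M = M"
  shows "x \<bullet> (M *v y) = (M *v x) \<bullet> y"
  using assms by (metis dot_lmul_matrix vector_transpose_matrix)

text \<open>For a nondegenerate conic the line equation singles out the polars of the points
  of the conic, and such a line meets the conic in its pole only.\<close>

lemma nondegenerate_line_equation_iff:
  assumes "is_conic (M, N)" and "invertible M"
  shows "l \<bullet> (N *v l) = 0 \<longleftrightarrow> (\<exists>p. p \<bullet> (M *v p) = 0 \<and> l = M *v p)"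
proof -
  obtain k where MN: "M ** N = mat k" and sM: "transpose M = M" and N0: "N \<noteq> 0"
    using assms(1) unfolding is_conic_def by auto
  obtain M' where M': "M' ** M = mat 1" using assms(2) unfolding invertible_def by blast
  have MNv: "M *v (N *v x) = k *\<^sub>R x" for x
    by (metis MN mat_vec matrix_vector_mul_assoc)
  have inj: "x = 0" if "M *v x = 0" for x
    by (metis M' that matrix_vector_mul_assoc matrix_vector_mul_lid matrix_vector_mult_0_right)
  have k0: "k \<noteq> 0"
  proof
    assume "k = 0"
    then have "N *v x = 0" for x using MNv inj by simp
    then have "N = 0" by (simp add: matrix_eq)
    then show False using N0 by simp
  qed
  have NMv: "N *v (M *v x) = k *\<^sub>R x" for x
  proof -
    have "M *v (N *v (M *v x) - k *\<^sub>R x) = 0"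
      by (simp add: MNv matrix_vector_mult_diff_distrib matrix_vector_mult_scaleR)
    then show ?thesis using inj by fastforce
  qed
  show ?thesis
  proof
    assume *: "l \<bullet> (N *v l) = 0"
    define p where "p = (1 / k) *\<^sub>R (N *v l)"
    have "M *v p = l" using k0 by (simp add: p_def MNv matrix_vector_mult_scaleR)
    moreover have "p \<bullet> l = 0" using * by (simp add: p_def inner_commute)
    ultimately show "\<exists>p. p \<bullet> (M *v p) = 0 \<and> l = M *v p" by metis
  next
    assume "\<exists>p. p \<bullet> (M *v p) = 0 \<and> l = M *v p"
    then show "l \<bullet> (N *v l) = 0" by (auto simp: NMv inner_commute)
  qed
qed

lemma nondegenerate_polar_meets_once:
  fixes M :: "real^3^3"
  assumes "transpose M = M" and "invertible M" and p: "p \<bullet> (M *v p) = 0" "p \<noteq> 0"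
    and q: "q \<bullet> (M *v q) = 0" "(M *v p) \<bullet> q = 0"
  shows "\<exists>c. q = c *\<^sub>R p"
proof (rule ccontr)
  assume nq: "\<nexists>c. q = c *\<^sub>R p"
  obtain M' where M': "M' ** M = mat 1" using assms(2) unfolding invertible_def by blast
  have inj: "x = 0" if "M *v x = 0" for x
    by (metis M' that matrix_vector_mul_assoc matrix_vector_mul_lid matrix_vector_mult_0_right)
  define n where "n = cross3 p q"
  have "\<not> collinear {0, p, q}" using nq p(2) by (auto simp: collinear_lemma)
  then have n0: "n \<noteq> 0" by (simp add: n_def cross_eq_0)
  have par: "\<exists>c. v = c *\<^sub>R n" if "v \<bullet> p = 0" "v \<bullet> q = 0" for v
  proof -
    have "cross3 v n = 0" using that by (simp add: n_def Lagrange)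
    then have "collinear {0, n, v}" by (simp add: cross_eq_0 insert_commute)
    then show ?thesis using n0 by (auto simp: collinear_lemma intro: exI[of _ 0])
  qed
  obtain a where a: "M *v p = a *\<^sub>R n" using par[of "M *v p"] p q by (auto simp: inner_commute)
  have "(M *v q) \<bullet> p = 0"
    using symmetric_inner[OF assms(1), of q p] q(2) by (simp add: inner_commute)
  then obtain b where b: "M *v q = b *\<^sub>R n" using par[of "M *v q"] q by (auto simp: inner_commute)
  have a0: "a \<noteq> 0" using a inj p(2) by auto
  have "M *v (b *\<^sub>R p - a *\<^sub>R q) = 0"
    by (simp add: a b matrix_vector_mult_diff_distrib matrix_vector_mult_scaleR)
  then have "b *\<^sub>R p = a *\<^sub>R q" using inj by fastforce
  then have "q = (b / a) *\<^sub>R p"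
    using a0 by (metis (no_types) divide_inverse_commute scaleR_left_imp_eq scaleR_scaleR mult.commute left_inverse scaleR_one)
  then show False using nq by blast
qed

end

theory Submission
  imports Defs
begin

text \<open>
  Let \<open>a, b, c\<close> be the homogeneous coordinate vectors of the vertices. A point of \<open>BC\<close> is
  \<open>u b + v c\<close>, and the cevian joining it to \<open>A\<close> is the cross product
  \<open>a \<times> (u b + v c) = - v (c \<times> a) + u (a \<times> b)\<close>. So relative to the dual triangle
  \<open>b \<times> c, c \<times> a, a \<times> b\<close> the six cevians are six vectors on the sides, just as the six
  points are relative to \<open>a, b, c\<close>; only the coordinate pair \<open>(u, v)\<close> has turned into
  \<open>(- v, u)\<close>. Since every nonzero symmetric matrix is both the point matrix and the line matrix
  of some conic, both halves of the theorem ask the same question: is there a nonzero quadratic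
  form that vanishes at two given places on each side of a triangle?

  The answer (\<open>conic_meets_sides_iff\<close>) is a version of Carnot's theorem. If the places
  \<open>(u\<^sub>1, v\<^sub>1)\<close>, \<open>(u\<^sub>2, v\<^sub>2)\<close> on a side differ, the restriction of the form to that side is
  determined by them up to a factor, and its end coefficients are in the ratio
  \<open>v\<^sub>1 v\<^sub>2 : u\<^sub>1 u\<^sub>2\<close>. The three restrictions fit together if and only if they agree at the
  vertices, which is a cyclic linear system for the three factors; it is solvable exactly
  when the product of the three \<open>v\<^sub>1 v\<^sub>2\<close> equals the product of the three \<open>u\<^sub>1 u\<^sub>2\<close>. If the
  two places on some side coincide, one condition is lost and a form always exists. Passing
  from \<open>(u, v)\<close> to \<open>(- v, u)\<close> interchanges the two products and preserves coincidence, hence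
  the criterion for the points and the criterion for the cevians are the same.
\<close>

section \<open>Conics through a set of vectors\<close>

text \<open>The vectors may stand for points or for lines, which lets one criterion serve both
  sides of the duality.\<close>

definition on_common_conic :: "(real^3) set \<Rightarrow> bool" where
  "on_common_conic S \<longleftrightarrow>
     (\<exists>M::real^3^3. transpose M = M \<and> M \<noteq> 0 \<and> (\<forall>x\<in>S. x \<bullet> (M *v x) = 0))"

text \<open>A projective change of coordinates replaces \<open>M\<close> by the congruent matrix
  \<open>P\<^sup>T M P\<close>, which is again symmetric and nonzero.\<close>

lemma on_common_conic_image:
  fixes P :: "real^3^3"
  assumes "invertible P"
  shows "on_common_conic ((*v) P ` S) \<longleftrightarrow> on_common_conic S"
proof -
  have adjoint: "x \<bullet> (transpose R *v z) = (R *v x) \<bullet> z" for R :: "real^3^3" and x z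
    by (metis dot_lmul_matrix vector_transpose_matrix)
  have form: "(R *v x) \<bullet> (M *v (R *v x)) = x \<bullet> ((transpose R ** M ** R) *v x)"
    for R M :: "real^3^3" and x
    by (simp add: matrix_vector_mul_assoc[symmetric] adjoint del: transpose_matrix_vector)
  have pull: "on_common_conic T" if R: "invertible R" "on_common_conic ((*v) R ` T)"
    for R :: "real^3^3" and T
  proof -
    obtain M :: "real^3^3" where M: "transpose M = M" "M \<noteq> 0"
      "\<forall>x\<in>T. (R *v x) \<bullet> (M *v (R *v x)) = 0"
      using R(2) unfolding on_common_conic_def by auto
    obtain R' where R': "R ** R' = mat 1"
      using R(1) unfolding invertible_def by blast
    have "transpose R' ** (transpose R ** M ** R) ** R' = transpose (R ** R') ** M ** (R ** R')"
      by (simp add: matrix_transpose_mul matrix_mul_assoc)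
    also have "\<dots> = M" by (simp add: R' transpose_mat)
    finally have "transpose R ** M ** R \<noteq> 0" using M(2) by fastforce
    moreover have "transpose (transpose R ** M ** R) = transpose R ** M ** R"
      by (simp add: matrix_transpose_mul M(1) matrix_mul_assoc)
    ultimately show ?thesis
      using M(3) unfolding on_common_conic_def form by blast
  qed
  obtain P' where P': "P ** P' = mat 1" "P' ** P = mat 1"
    using assms unfolding invertible_def by blast
  then have "invertible P'" unfolding invertible_def by blast
  moreover have "(*v) P' ` ((*v) P ` S) = S"
    by (simp add: image_image matrix_vector_mul_assoc P')
  ultimately show ?thesis using pull[OF assms, of S] pull[of P' "(*v) P ` S"] by auto
qed

text \<open>An invertible matrix is completed by its inverse. A singular one kills some \<open>x \<noteq> 0\<close> and is
  completed by \<open>x x\<^sup>T\<close>, with both products equal to zero. Since the completion works on either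
  side, the matrix may be used as the point equation or as the line equation.\<close>

lemma complete_conic_exists:
  fixes M :: "real^3^3"
  assumes M: "transpose M = M" "M \<noteq> 0"
  shows "\<exists>N. transpose N = N \<and> N \<noteq> 0 \<and> (\<exists>k. M ** N = mat k \<and> N ** M = mat k)"
proof (cases "invertible M")
  case True
  then obtain N where N: "M ** N = mat 1" "N ** M = mat 1"
    unfolding invertible_def by blast
  have "transpose N ** M = mat 1"
    by (metis M(1) N(1) matrix_transpose_mul transpose_mat)
  then have "transpose N = N"
    by (metis N(1) matrix_mul_assoc matrix_mul_lid matrix_mul_rid)
  moreover have "N \<noteq> 0"
    using N(1) M(2) by (metis matrix_mul_assoc matrix_mul_lid times0_left times0_right)
  ultimately show ?thesis using N by blast
next
  case False
  then obtain x where x: "M *v x = 0" "x \<noteq> 0"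
    by (metis invertible_left_inverse matrix_left_invertible_ker)
  define N where "N = (\<chi> i j. x $ i * x $ j)"
  have sN: "transpose N = N"
    by (simp add: N_def transpose_def vec_eq_iff mult.commute)
  have "M ** N = (\<chi> i j. (M *v x) $ i * x $ j)"
    by (simp add: N_def matrix_matrix_mult_def matrix_vector_mult_def vec_eq_iff
        sum_distrib_right mult.assoc)
  then have MN: "M ** N = mat 0" by (simp add: x(1) vec_eq_iff mat_def)
  then have "N ** M = mat 0"
    by (metis M(1) sN matrix_transpose_mul transpose_mat)
  moreover have "N \<noteq> 0" using x(2) by (auto simp: N_def vec_eq_iff)
  ultimately show ?thesis using sN MN by blast
qed

lemma ex_conic_point_form:
  "(\<exists>K. is_conic K \<and> (\<forall>x\<in>S. x \<bullet> (fst K *v x) = 0)) \<longleftrightarrow> on_common_conic S"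
proof
  assume "on_common_conic S"
  then obtain M where "transpose M = M" "M \<noteq> 0" "\<forall>x\<in>S. x \<bullet> (M *v x) = 0"
    unfolding on_common_conic_def by blast
  moreover from this obtain N where "is_conic (M, N)"
    using complete_conic_exists[of M] unfolding is_conic_def by auto
  ultimately show "\<exists>K. is_conic K \<and> (\<forall>x\<in>S. x \<bullet> (fst K *v x) = 0)"
    by (intro exI[of _ "(M, N)"]) simp
qed (auto simp: on_common_conic_def is_conic_def)

lemma ex_conic_line_form:
  "(\<exists>K. is_conic K \<and> (\<forall>l\<in>S. l \<bullet> (snd K *v l) = 0)) \<longleftrightarrow> on_common_conic S"
proof
  assume "on_common_conic S"
  then obtain N where "transpose N = N" "N \<noteq> 0" "\<forall>x\<in>S. x \<bullet> (N *v x) = 0"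
    unfolding on_common_conic_def by blast
  moreover from this obtain M where "is_conic (M, N)"
    using complete_conic_exists[of N] unfolding is_conic_def by auto
  ultimately show "\<exists>K. is_conic K \<and> (\<forall>l\<in>S. l \<bullet> (snd K *v l) = 0)"
    by (intro exI[of _ "(M, N)"]) simp
qed (auto simp: on_common_conic_def is_conic_def)

section \<open>Tangency of a line through two points\<close>

lemma line_through_eq_line_of_coords:
  assumes "P \<noteq> Q"
  shows "line_through P Q = line_of_coords (cross3 (homog P) (homog Q))"
proof (intro set_eqI iffI)
  have on_line: "X \<in> line_of_coords (cross3 (homog P) (homog Q)) \<longleftrightarrow>
      (X$1 - P$1) * (Q$2 - P$2) = (X$2 - P$2) * (Q$1 - P$1)" for X
    by (auto simp: line_of_coords_def homog_def cross3_def inner_vec_def sum_3 algebra_simps)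
  {
    fix X assume "X \<in> line_through P Q"
    then obtain t where "X = P + t *\<^sub>R (Q - P)" by (auto simp: affine_hull_2_alt)
    then show "X \<in> line_of_coords (cross3 (homog P) (homog Q))"
      by (simp add: on_line)
  }
  fix X assume "X \<in> line_of_coords (cross3 (homog P) (homog Q))"
  then have X: "(X$1 - P$1) * (Q$2 - P$2) = (X$2 - P$2) * (Q$1 - P$1)"
    by (simp add: on_line)
  have "Q$1 - P$1 \<noteq> 0 \<or> Q$2 - P$2 \<noteq> 0"
    using assms by (auto simp: vec_eq_iff forall_2)
  then have "\<exists>t. X$1 - P$1 = t * (Q$1 - P$1) \<and> X$2 - P$2 = t * (Q$2 - P$2)"
  proof
    assume "Q$1 - P$1 \<noteq> 0"
    then show ?thesis
      using X by (intro exI[of _ "(X$1 - P$1) / (Q$1 - P$1)"]) (simp add: field_simps)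
  next
    assume "Q$2 - P$2 \<noteq> 0"
    then show ?thesis
      using X by (intro exI[of _ "(X$2 - P$2) / (Q$2 - P$2)"]) (simp add: field_simps)
  qed
  then obtain t where "X$1 - P$1 = t * (Q$1 - P$1)" "X$2 - P$2 = t * (Q$2 - P$2)" by blast
  then have "X = P + t *\<^sub>R (Q - P)" by (simp add: vec_eq_iff forall_2)
  then show "X \<in> line_through P Q" by (auto simp: affine_hull_2_alt)
qed

text \<open>The coordinate vector of a line is unique up to a factor, because any vector orthogonal to
  both points is a multiple of their cross product. Hence tangency can be tested on the cross
  product alone.\<close>

lemma tangent_of_line_through:
  assumes "P \<noteq> Q"
  defines "l \<equiv> cross3 (homog P) (homog Q)"
  shows "tangent_of (line_through P Q) K \<longleftrightarrow> l \<bullet> (snd K *v l) = 0"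
proof
  have l0: "l \<noteq> 0"
    using assms(1) by (auto simp: l_def cross3_def homog_def vec_eq_iff forall_2 forall_3)
  {
    assume "l \<bullet> (snd K *v l) = 0"
    then show "tangent_of (line_through P Q) K"
      unfolding tangent_of_def
      using l0 line_through_eq_line_of_coords[OF assms(1)] by (auto simp: l_def)
  next
    assume "tangent_of (line_through P Q) K"
    then obtain m where m: "m \<noteq> 0" "line_through P Q = line_of_coords m"
      "m \<bullet> (snd K *v m) = 0"
      unfolding tangent_of_def by blast
    have "P \<in> line_of_coords m" "Q \<in> line_of_coords m"
      unfolding m(2)[symmetric] by (simp_all add: hull_inc)
    then have "cross3 m l = 0"
      by (simp add: l_def Lagrange line_of_coords_def)
    then have "collinear {0, m, l}" by (simp add: cross_eq_0)
    then obtain c where "l = c *\<^sub>R m"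
      using m(1) l0 by (auto simp: collinear_lemma)
    then show "l \<bullet> (snd K *v l) = 0"
      using m(3) by (simp add: matrix_vector_mult_scaleR)
  }
qed

section \<open>A Carnot criterion on the sides of a triangle\<close>

text \<open>A binary quadratic form with two distinct roots is a multiple of the product of the
  corresponding linear forms, \<open>k (v\<^sub>1 x - u\<^sub>1 y) (v\<^sub>2 x - u\<^sub>2 y)\<close>.\<close>

lemma binary_form_roots:
  fixes \<alpha> \<beta> \<gamma> u1 v1 u2 v2 :: real
  assumes "u1 * v2 \<noteq> u2 * v1"
    and "\<alpha> * u1\<^sup>2 + \<beta> * u1 * v1 + \<gamma> * v1\<^sup>2 = 0" "\<alpha> * u2\<^sup>2 + \<beta> * u2 * v2 + \<gamma> * v2\<^sup>2 = 0"
  shows "\<exists>k. \<alpha> = k * (v1 * v2) \<and> \<beta> = - k * (u1 * v2 + u2 * v1) \<and> \<gamma> = k * (u1 * u2)"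
proof -
  \<comment> \<open>Evaluating the polar form at the two roots isolates the factor: twice its value there is
    \<open>- k D\<close>.\<close>
  define D where "D = (u1 * v2 - u2 * v1)\<^sup>2"
  define E where "E = - (2 * \<alpha> * u1 * u2 + \<beta> * (u1 * v2 + u2 * v1) + 2 * \<gamma> * v1 * v2)"
  have D: "D \<noteq> 0" using assms(1) by (simp add: D_def)
  have "\<alpha> * D = E * (v1 * v2)" "\<beta> * D = - E * (u1 * v2 + u2 * v1)" "\<gamma> * D = E * (u1 * u2)"
    using assms(2,3) unfolding D_def E_def by algebra+
  then show ?thesis using D by (intro exI[of _ "E / D"]) (simp add: field_simps)
qed

text \<open>The determinant of the system is the difference of the two products.\<close>

lemma cyclic_system_iff:
  fixes pa pb pc qa qb qc :: real
  shows "(\<exists>x y z. (x \<noteq> 0 \<or> y \<noteq> 0 \<or> z \<noteq> 0) \<and>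
            x * qa = y * pb \<and> y * qb = z * pc \<and> z * qc = x * pa) \<longleftrightarrow> pa * pb * pc = qa * qb * qc"
proof -
  define M :: "real^3^3" where
    "M = vector [vector [qa, - pb, 0], vector [0, qb, - pc], vector [- pa, 0, qc]]"
  have "det M = qa * qb * qc - pa * pb * pc"
    by (simp add: M_def det_3)
  moreover have "det M = 0 \<longleftrightarrow> (\<exists>x. M *v x = 0 \<and> x \<noteq> 0)"
    by (metis invertible_det_nz invertible_left_inverse matrix_left_invertible_ker)
  moreover have "\<dots> \<longleftrightarrow> (\<exists>x y z. (x \<noteq> 0 \<or> y \<noteq> 0 \<or> z \<noteq> 0) \<and>
      x * qa = y * pb \<and> y * qb = z * pc \<and> z * qc = x * pa)"
  proof
    assume "\<exists>x. M *v x = 0 \<and> x \<noteq> 0"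
    then obtain x where "M *v x = 0" "x \<noteq> 0" by blast
    then show "\<exists>x y z. (x \<noteq> 0 \<or> y \<noteq> 0 \<or> z \<noteq> 0) \<and>
        x * qa = y * pb \<and> y * qb = z * pc \<and> z * qc = x * pa"
      by (intro exI[of _ "x$1"] exI[of _ "x$2"] exI[of _ "x$3"])
        (auto simp: M_def matrix_vector_mult_def vec_eq_iff forall_3 sum_3 mult.commute)
  next
    assume "\<exists>x y z. (x \<noteq> 0 \<or> y \<noteq> 0 \<or> z \<noteq> 0) \<and>
        x * qa = y * pb \<and> y * qb = z * pc \<and> z * qc = x * pa"
    then obtain x y z where "x \<noteq> 0 \<or> y \<noteq> 0 \<or> z \<noteq> 0"
        "x * qa = y * pb" "y * qb = z * pc" "z * qc = x * pa" by blast
    then show "\<exists>x. M *v x = 0 \<and> x \<noteq> 0"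
      by (intro exI[of _ "vector [x, y, z]"])
        (auto simp: M_def matrix_vector_mult_def vec_eq_iff forall_3 sum_3 mult.commute)
  qed
  ultimately show ?thesis by argo
qed

text \<open>For places distinct from the vertices, this is Carnot's condition that the product of
  the six division ratios \<open>v / u\<close> be \<open>1\<close>. The form without quotients also covers places at
  the vertices.\<close>

abbreviation carnot_relation :: "real \<times> real \<Rightarrow> real \<times> real \<Rightarrow> real \<times> real \<Rightarrow> real \<times> real \<Rightarrow>
    real \<times> real \<Rightarrow> real \<times> real \<Rightarrow> bool" where
  "carnot_relation a1 a2 b1 b2 c1 c2 \<equiv>
     (snd a1 * snd a2) * (snd b1 * snd b2) * (snd c1 * snd c2) =
     (fst a1 * fst a2) * (fst b1 * fst b2) * (fst c1 * fst c2)"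

text \<open>A pair \<open>(u, v)\<close> gives the coordinates of a place on a side with respect to its two
  endpoints, taken in the cyclic order \<open>B, C\<close>, then \<open>C, A\<close>, then \<open>A, B\<close>. The rotation
  keeps the criterion cyclically symmetric and accounts for the swapped entries on \<open>CA\<close>.\<close>

abbreviation on_BC :: "real \<times> real \<Rightarrow> real^3" where "on_BC r \<equiv> vector [0, fst r, snd r]"
abbreviation on_CA :: "real \<times> real \<Rightarrow> real^3" where "on_CA r \<equiv> vector [snd r, 0, fst r]"
abbreviation on_AB :: "real \<times> real \<Rightarrow> real^3" where "on_AB r \<equiv> vector [fst r, snd r, 0]"

abbreviation same_ratio :: "real \<times> real \<Rightarrow> real \<times> real \<Rightarrow> bool" where
  "same_ratio r s \<equiv> fst r * snd s = fst s * snd r"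

lemma symmetric_3_entries:
  fixes M :: "real^3^3"
  assumes "transpose M = M"
  shows "M$2$1 = M$1$2" "M$3$2 = M$2$3" "M$1$3 = M$3$1"
proof -
  have "M$j$i = M$i$j" for i j
    using arg_cong[OF assms, of "\<lambda>A. A$i$j"] by (simp add: transpose_def)
  then show "M$2$1 = M$1$2" "M$3$2 = M$2$3" "M$1$3 = M$3$1" by blast+
qed

lemma form_on_sides:
  fixes M :: "real^3^3"
  assumes "transpose M = M"
  shows "on_BC r \<bullet> (M *v on_BC r) = M$2$2 * (fst r)\<^sup>2 + 2 * M$2$3 * fst r * snd r + M$3$3 * (snd r)\<^sup>2"
    and "on_CA r \<bullet> (M *v on_CA r) = M$3$3 * (fst r)\<^sup>2 + 2 * M$3$1 * fst r * snd r + M$1$1 * (snd r)\<^sup>2"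
    and "on_AB r \<bullet> (M *v on_AB r) = M$1$1 * (fst r)\<^sup>2 + 2 * M$1$2 * fst r * snd r + M$2$2 * (snd r)\<^sup>2"
  by (simp_all add: matrix_vector_mult_def inner_vec_def sum_3 symmetric_3_entries[OF assms]
      power2_eq_square algebra_simps)

lemma form_zero_same_ratio:
  fixes r s :: "real \<times> real"
  assumes "r \<noteq> 0" "same_ratio r s"
    and "\<alpha> * (fst r)\<^sup>2 + \<beta> * fst r * snd r + \<gamma> * (snd r)\<^sup>2 = 0"
  shows "\<alpha> * (fst s)\<^sup>2 + \<beta> * fst s * snd s + \<gamma> * (snd s)\<^sup>2 = 0"
proof -
  have "fst r \<noteq> 0 \<or> snd r \<noteq> 0" using assms(1) by (simp add: prod_eq_iff)
  moreover have "(fst r)\<^sup>2 * (\<alpha> * (fst s)\<^sup>2 + \<beta> * fst s * snd s + \<gamma> * (snd s)\<^sup>2) = 0"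
    "(snd r)\<^sup>2 * (\<alpha> * (fst s)\<^sup>2 + \<beta> * fst s * snd s + \<gamma> * (snd s)\<^sup>2) = 0"
    using assms(2,3) by algebra+
  ultimately show ?thesis by auto
qed

text \<open>A solution \<open>x, y, z\<close> of the cyclic system prescribes a multiple of the product of
  linear forms on each side, and the system says that the coefficients shared by two sides
  agree. So they assemble to one symmetric matrix.\<close>

lemma carnot_imp_conic:
  assumes nz: "a1 \<noteq> 0" "a2 \<noteq> 0" "b1 \<noteq> 0" "b2 \<noteq> 0" "c1 \<noteq> 0" "c2 \<noteq> 0"
    and "carnot_relation a1 a2 b1 b2 c1 c2"
  shows "on_common_conic {on_BC a1, on_BC a2, on_CA b1, on_CA b2, on_AB c1, on_AB c2}"
proof -
  obtain x y z where xyz: "x \<noteq> 0 \<or> y \<noteq> 0 \<or> z \<noteq> 0"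
      "x * (fst a1 * fst a2) = y * (snd b1 * snd b2)"
      "y * (fst b1 * fst b2) = z * (snd c1 * snd c2)"
      "z * (fst c1 * fst c2) = x * (snd a1 * snd a2)"
    using iffD2[OF cyclic_system_iff assms(7)] by blast
  \<comment> \<open>Half the middle coefficient of a multiple of the product of the two linear forms.\<close>
  define mid where "mid = (\<lambda>w (r::real\<times>real) s. - w * (fst r * snd s + fst s * snd r) / 2 :: real)"
  define M :: "real^3^3" where "M =
    vector [vector [z * (snd c1 * snd c2), mid z c1 c2, mid y b1 b2],
            vector [mid z c1 c2, x * (snd a1 * snd a2), mid x a1 a2],
            vector [mid y b1 b2, mid x a1 a2, y * (snd b1 * snd b2)]]"
  have sM: "transpose M = M"
    by (simp add: M_def transpose_def vec_eq_iff forall_3)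
  have root: "w * (snd r * snd s) * (fst t)\<^sup>2 + 2 * mid w r s * fst t * snd t
      + w * (fst r * fst s) * (snd t)\<^sup>2 = w * (snd r * fst t - fst r * snd t) * (snd s * fst t - fst s * snd t)"
    for w r s t
    by (simp add: mid_def power2_eq_square field_simps)
  \<comment> \<open>A product of two nonzero linear forms is nonzero, so no factor gets lost in the matrix.\<close>
  have product_zero: "w = 0" if "r \<noteq> 0" "s \<noteq> 0" "mid w r s = 0"
      "w * (snd r * snd s) = 0" "w * (fst r * fst s) = 0" for w r s
  proof (rule ccontr)
    assume "w \<noteq> 0"
    then have "fst r * snd s + fst s * snd r = 0" "snd r * snd s = 0" "fst r * fst s = 0"
      using that(3-5) by (auto simp: mid_def)
    then show False using that(1,2) by (auto simp: prod_eq_iff)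
  qed
  have "M \<noteq> 0"
  proof
    assume "M = 0"
    then have "M $ i $ j = 0" for i j by simp
    from this[of 1 1] this[of 2 2] this[of 3 3] this[of 1 2] this[of 2 3] this[of 3 1]
    have "z * (snd c1 * snd c2) = 0" "x * (snd a1 * snd a2) = 0" "y * (snd b1 * snd b2) = 0"
      "mid z c1 c2 = 0" "mid x a1 a2 = 0" "mid y b1 b2 = 0"
      unfolding M_def by (simp_all only: vector_3)
    then have "x = 0" "y = 0" "z = 0"
      using product_zero[OF nz(1,2), of x] product_zero[OF nz(3,4), of y]
        product_zero[OF nz(5,6), of z] unfolding xyz(2-4) by blast+
    then show False using xyz(1) by simp
  qed
  moreover have "p \<bullet> (M *v p) = 0"
    if "p \<in> {on_BC a1, on_BC a2, on_CA b1, on_CA b2, on_AB c1, on_AB c2}" for p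
  proof -
    have BC: "on_BC t \<bullet> (M *v on_BC t) =
      x * (snd a1 * fst t - fst a1 * snd t) * (snd a2 * fst t - fst a2 * snd t)" for t
      unfolding form_on_sides(1)[OF sM] root[symmetric] by (simp add: M_def xyz)
    have CA: "on_CA t \<bullet> (M *v on_CA t) =
      y * (snd b1 * fst t - fst b1 * snd t) * (snd b2 * fst t - fst b2 * snd t)" for t
      unfolding form_on_sides(2)[OF sM] root[symmetric] by (simp add: M_def xyz)
    have AB: "on_AB t \<bullet> (M *v on_AB t) =
      z * (snd c1 * fst t - fst c1 * snd t) * (snd c2 * fst t - fst c2 * snd t)" for t
      unfolding form_on_sides(3)[OF sM] root[symmetric] by (simp add: M_def xyz)
    from that show ?thesis by (auto simp: BC CA AB)
  qed
  ultimately show ?thesis using sM unfolding on_common_conic_def by blast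
qed

text \<open>When the two places on a side coincide, one of them may be moved freely. This lemma finds
  a new position that makes the Carnot relation hold, \<open>K\<close> and \<open>L\<close> being the contributions of
  the other two sides.\<close>

lemma ratio_completion:
  fixes r :: "real \<times> real" and K L :: real
  shows "\<exists>s. s \<noteq> 0 \<and> (snd r * snd s) * K = (fst r * fst s) * L"
proof (cases "snd r * K = 0 \<and> fst r * L = 0")
  case True
  then show ?thesis by (intro exI[of _ "(1, 1)"]) (auto simp: prod_eq_iff)
next
  case False
  then show ?thesis
    by (intro exI[of _ "(snd r * K, fst r * L)"]) (auto simp: prod_eq_iff)
qed

text \<open>With distinct places on every side, the three restrictions of the form are multiples of
  products of linear forms, and comparing their values at the vertices yields the cyclic
  system. With a coincidence on one side, the second place there is replaced so that the
  Carnot relation holds; the conic so obtained still passes through the double place.\<close>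

lemma conic_meets_sides_iff:
  assumes nz: "a1 \<noteq> 0" "a2 \<noteq> 0" "b1 \<noteq> 0" "b2 \<noteq> 0" "c1 \<noteq> 0" "c2 \<noteq> 0"
  shows "on_common_conic {on_BC a1, on_BC a2, on_CA b1, on_CA b2, on_AB c1, on_AB c2} \<longleftrightarrow>
     same_ratio a1 a2 \<or> same_ratio b1 b2 \<or> same_ratio c1 c2 \<or> carnot_relation a1 a2 b1 b2 c1 c2"
    (is "?conic \<longleftrightarrow> ?cond")
proof
  assume ?conic
  then obtain M where M: "transpose M = M" "M \<noteq> 0"
    "\<forall>x\<in>{on_BC a1, on_BC a2, on_CA b1, on_CA b2, on_AB c1, on_AB c2}. x \<bullet> (M *v x) = 0"
    unfolding on_common_conic_def by blast
  show ?cond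
  proof (rule ccontr)
    assume neg: "\<not> ?cond"
    note zeros = M(3)[unfolded ball_simps form_on_sides[OF M(1)]]
    obtain x where x: "M$2$2 = x * (snd a1 * snd a2)" "2 * M$2$3 = - x * (fst a1 * snd a2 + fst a2 * snd a1)"
        "M$3$3 = x * (fst a1 * fst a2)"
      using binary_form_roots[of "fst a1" "snd a2" "fst a2" "snd a1" "M$2$2" "2 * M$2$3" "M$3$3"]
        neg zeros by auto
    obtain y where y: "M$3$3 = y * (snd b1 * snd b2)" "2 * M$3$1 = - y * (fst b1 * snd b2 + fst b2 * snd b1)"
        "M$1$1 = y * (fst b1 * fst b2)"
      using binary_form_roots[of "fst b1" "snd b2" "fst b2" "snd b1" "M$3$3" "2 * M$3$1" "M$1$1"]
        neg zeros by auto
    obtain z where z: "M$1$1 = z * (snd c1 * snd c2)" "2 * M$1$2 = - z * (fst c1 * snd c2 + fst c2 * snd c1)"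
        "M$2$2 = z * (fst c1 * fst c2)"
      using binary_form_roots[of "fst c1" "snd c2" "fst c2" "snd c1" "M$1$1" "2 * M$1$2" "M$2$2"]
        neg zeros by auto
    \<comment> \<open>The three sides together involve all six entries of \<open>M\<close>.\<close>
    have "x \<noteq> 0 \<or> y \<noteq> 0 \<or> z \<noteq> 0"
    proof (rule ccontr)
      assume "\<not> (x \<noteq> 0 \<or> y \<noteq> 0 \<or> z \<noteq> 0)"
      then have "M = 0"
        using x y z by (simp add: vec_eq_iff forall_3 symmetric_3_entries[OF M(1)])
      then show False using M(2) by simp
    qed
    moreover have "x * (fst a1 * fst a2) = y * (snd b1 * snd b2)"
      "y * (fst b1 * fst b2) = z * (snd c1 * snd c2)"
      "z * (fst c1 * fst c2) = x * (snd a1 * snd a2)"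
      using x y z by auto
    ultimately have "carnot_relation a1 a2 b1 b2 c1 c2" by (intro iffD1[OF cyclic_system_iff]) blast
    then show False using neg by blast
  qed
next
  assume ?cond
  then consider "same_ratio a1 a2" | "same_ratio b1 b2" | "same_ratio c1 c2"
    | "carnot_relation a1 a2 b1 b2 c1 c2" by blast
  then show ?conic
  proof cases
    case 1
    obtain s where s: "s \<noteq> 0" "(snd a1 * snd s) * ((snd b1 * snd b2) * (snd c1 * snd c2))
        = (fst a1 * fst s) * ((fst b1 * fst b2) * (fst c1 * fst c2))"
      using ratio_completion by blast
    then have "on_common_conic {on_BC a1, on_BC s, on_CA b1, on_CA b2, on_AB c1, on_AB c2}"
      using nz by (intro carnot_imp_conic) (auto simp: mult.assoc)
    then show ?thesis
      using form_zero_same_ratio[OF nz(1) 1]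
      unfolding on_common_conic_def by (force simp: form_on_sides)
  next
    case 2
    obtain s where s: "s \<noteq> 0" "(snd b1 * snd s) * ((snd a1 * snd a2) * (snd c1 * snd c2))
        = (fst b1 * fst s) * ((fst a1 * fst a2) * (fst c1 * fst c2))"
      using ratio_completion by blast
    then have "on_common_conic {on_BC a1, on_BC a2, on_CA b1, on_CA s, on_AB c1, on_AB c2}"
      using nz by (intro carnot_imp_conic) (auto simp: mult_ac)
    then show ?thesis
      using form_zero_same_ratio[OF nz(3) 2]
      unfolding on_common_conic_def by (force simp: form_on_sides)
  next
    case 3
    obtain s where s: "s \<noteq> 0" "(snd c1 * snd s) * ((snd a1 * snd a2) * (snd b1 * snd b2))
        = (fst c1 * fst s) * ((fst a1 * fst a2) * (fst b1 * fst b2))"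
      using ratio_completion by blast
    then have "on_common_conic {on_BC a1, on_BC a2, on_CA b1, on_CA b2, on_AB c1, on_AB s}"
      using nz by (intro carnot_imp_conic) (auto simp: mult_ac)
    then show ?thesis
      using form_zero_same_ratio[OF nz(5) 3]
      unfolding on_common_conic_def by (force simp: form_on_sides)
  next
    case 4
    then show ?thesis using carnot_imp_conic nz by blast
  qed
qed

section \<open>The triangle and its dual\<close>

definition frame :: "real^3 \<Rightarrow> real^3 \<Rightarrow> real^3 \<Rightarrow> real^3^3" where
  "frame a b c = transpose (vector [a, b, c])"

lemma frame_mult: "frame a b c *v vector [x, y, z] = x *\<^sub>R a + y *\<^sub>R b + z *\<^sub>R c"
  by (simp add: frame_def transpose_def matrix_vector_mult_def vec_eq_iff sum_3 mult.commute)

lemma det_frame: "det (frame a b c) = a \<bullet> cross3 b c"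
  by (simp add: frame_def det_transpose dot_cross_det)

text \<open>The dual frame is the cofactor matrix, whose determinant in dimension three is the
  square.\<close>

lemma det_dual_frame:
  "det (frame (cross3 b c) (cross3 c a) (cross3 a b)) = (det (frame a b c))\<^sup>2"
  by (simp add: det_frame cross3_def inner_vec_def sum_3 power2_eq_square algebra_simps)

text \<open>The passage from a place on a side to the coordinates, in the dual frame, of the cevian
  through it: \<open>a \<times> (u b + v c) = - v (c \<times> a) + u (a \<times> b)\<close>.\<close>

definition cevian_coords :: "real \<times> real \<Rightarrow> real \<times> real" where
  "cevian_coords r = (- snd r, fst r)"

lemma homog_affine_combination:
  assumes "u + v = 1"
  shows "homog (u *\<^sub>R P + v *\<^sub>R Q) = u *\<^sub>R homog P + v *\<^sub>R homog Q"
  using assms by (simp add: homog_def vec_eq_iff forall_3)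

lemma barycentric_on_line:
  assumes "X \<in> line_through P Q"
  obtains r where "r \<noteq> 0" "homog X = fst r *\<^sub>R homog P + snd r *\<^sub>R homog Q"
proof -
  obtain u v where uv: "u + v = 1" "X = u *\<^sub>R P + v *\<^sub>R Q"
    using assms by (auto simp: affine_hull_2)
  show thesis
    by (rule that[of "(u, v)"]) (use uv in \<open>auto simp: homog_affine_combination prod_eq_iff\<close>)
qed

theorem theorem1p2:
  fixes A B C A1 A2 B1 B2 C1 C2 :: "real^2"
  assumes triangle: "\<not> collinear {A, B, C}"
    and "A1 \<in> line_through B C" and "A2 \<in> line_through B C"
    and "B1 \<in> line_through C A" and "B2 \<in> line_through C A"
    and "C1 \<in> line_through A B" and "C2 \<in> line_through A B"
  shows "(\<exists>\<D>. is_conic \<D> \<and>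
            tangent_of (line_through A A1) \<D> \<and> tangent_of (line_through A A2) \<D> \<and>
            tangent_of (line_through B B1) \<D> \<and> tangent_of (line_through B B2) \<D> \<and>
            tangent_of (line_through C C1) \<D> \<and> tangent_of (line_through C C2) \<D>)
     \<longleftrightarrow> (\<exists>\<C>. is_conic \<C> \<and>
            lies_on A1 \<C> \<and> lies_on A2 \<C> \<and> lies_on B1 \<C> \<and> lies_on B2 \<C> \<and>
            lies_on C1 \<C> \<and> lies_on C2 \<C>)"
proof -
  have "A \<noteq> B" "B \<noteq> C" "C \<noteq> A" using triangle by (auto simp: insert_commute)
  then have vertex_off: "A \<notin> line_through B C" "B \<notin> line_through C A" "C \<notin> line_through A B"
    using triangle collinear_3_affine_hull[of B C A] collinear_3_affine_hull[of C A B]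
      collinear_3_affine_hull[of A B C] by (simp_all add: insert_commute)
  then have cevians: "A \<noteq> A1" "A \<noteq> A2" "B \<noteq> B1" "B \<noteq> B2" "C \<noteq> C1" "C \<noteq> C2"
    using assms(2-7) by auto
  define a b c where abc: "a = homog A" "b = homog B" "c = homog C"
  define P where "P = frame a b c"
  define P' where "P' = frame (cross3 b c) (cross3 c a) (cross3 a b)"
  have "det P \<noteq> 0"
    using vertex_off(1) \<open>B \<noteq> C\<close>
    by (simp add: P_def det_frame abc line_through_eq_line_of_coords line_of_coords_def inner_commute)
  moreover from this have "det P' \<noteq> 0" by (simp add: P_def P'_def det_dual_frame)
  ultimately have inv: "invertible P" "invertible P'" by (simp_all add: invertible_det_nz)

  obtain a1 where a1: "a1 \<noteq> 0" "homog A1 = fst a1 *\<^sub>R b + snd a1 *\<^sub>R c"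
    using barycentric_on_line[OF assms(2)] abc by metis
  obtain a2 where a2: "a2 \<noteq> 0" "homog A2 = fst a2 *\<^sub>R b + snd a2 *\<^sub>R c"
    using barycentric_on_line[OF assms(3)] abc by metis
  obtain b1 where b1: "b1 \<noteq> 0" "homog B1 = fst b1 *\<^sub>R c + snd b1 *\<^sub>R a"
    using barycentric_on_line[OF assms(4)] abc by metis
  obtain b2 where b2: "b2 \<noteq> 0" "homog B2 = fst b2 *\<^sub>R c + snd b2 *\<^sub>R a"
    using barycentric_on_line[OF assms(5)] abc by metis
  obtain c1 where c1: "c1 \<noteq> 0" "homog C1 = fst c1 *\<^sub>R a + snd c1 *\<^sub>R b"
    using barycentric_on_line[OF assms(6)] abc by metis
  obtain c2 where c2: "c2 \<noteq> 0" "homog C2 = fst c2 *\<^sub>R a + snd c2 *\<^sub>R b"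
    using barycentric_on_line[OF assms(7)] abc by metis

  have pts: "P *v on_BC r = fst r *\<^sub>R b + snd r *\<^sub>R c"
    "P *v on_CA r = fst r *\<^sub>R c + snd r *\<^sub>R a"
    "P *v on_AB r = fst r *\<^sub>R a + snd r *\<^sub>R b" for r
    by (simp_all add: P_def frame_mult add.commute)
  \<comment> \<open>In the dual frame the cevians sit on the sides as the points do in the original one.\<close>
  have lns: "P' *v on_BC (cevian_coords r) = cross3 a (fst r *\<^sub>R b + snd r *\<^sub>R c)"
    "P' *v on_CA (cevian_coords r) = cross3 b (fst r *\<^sub>R c + snd r *\<^sub>R a)"
    "P' *v on_AB (cevian_coords r) = cross3 c (fst r *\<^sub>R a + snd r *\<^sub>R b)" for r
    by (simp_all add: P'_def cevian_coords_def frame_mult)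
       (simp_all add: cross3_def vec_eq_iff forall_3 algebra_simps)
  have cevian0: "cevian_coords r \<noteq> 0" if "r \<noteq> 0" for r
    using that by (auto simp: cevian_coords_def prod_eq_iff)

  have "(\<exists>\<C>. is_conic \<C> \<and> lies_on A1 \<C> \<and> lies_on A2 \<C> \<and> lies_on B1 \<C> \<and> lies_on B2 \<C> \<and>
            lies_on C1 \<C> \<and> lies_on C2 \<C>) \<longleftrightarrow>
    on_common_conic ((*v) P ` {on_BC a1, on_BC a2, on_CA b1, on_CA b2, on_AB c1, on_AB c2})"
    unfolding ex_conic_point_form[symmetric]
    by (simp add: pts lies_on_def a1 a2 b1 b2 c1 c2)
  also have "\<dots> \<longleftrightarrow> same_ratio a1 a2 \<or> same_ratio b1 b2 \<or> same_ratio c1 c2 \<or> carnot_relation a1 a2 b1 b2 c1 c2"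
    unfolding on_common_conic_image[OF inv(1)]
    by (rule conic_meets_sides_iff) (fact a1 a2 b1 b2 c1 c2)+
  also have "\<dots> \<longleftrightarrow> same_ratio (cevian_coords a1) (cevian_coords a2) \<or> same_ratio (cevian_coords b1) (cevian_coords b2) \<or>
      same_ratio (cevian_coords c1) (cevian_coords c2) \<or> carnot_relation (cevian_coords a1) (cevian_coords a2) (cevian_coords b1) (cevian_coords b2) (cevian_coords c1) (cevian_coords c2)"
    by (auto simp: cevian_coords_def mult.commute)
  also have "\<dots> \<longleftrightarrow> on_common_conic ((*v) P' ` {on_BC (cevian_coords a1), on_BC (cevian_coords a2),
      on_CA (cevian_coords b1), on_CA (cevian_coords b2), on_AB (cevian_coords c1), on_AB (cevian_coords c2)})"
    unfolding on_common_conic_image[OF inv(2)]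
    by (rule conic_meets_sides_iff[symmetric]; rule cevian0; fact a1 a2 b1 b2 c1 c2)
  also have "\<dots> \<longleftrightarrow> (\<exists>\<D>. is_conic \<D> \<and>
            tangent_of (line_through A A1) \<D> \<and> tangent_of (line_through A A2) \<D> \<and>
            tangent_of (line_through B B1) \<D> \<and> tangent_of (line_through B B2) \<D> \<and>
            tangent_of (line_through C C1) \<D> \<and> tangent_of (line_through C C2) \<D>)"
    unfolding ex_conic_line_form[symmetric]
    by (simp add: lns tangent_of_line_through cevians a1(2) a2(2) b1(2) b2(2) c1(2) c2(2) flip: abc)
  finally show ?thesis by blast
qed

end
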